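(* Let $\mathcal A\subseteq\mathbb R$ be a binary alphabet, let $s=(b_k,n_k)_{k\in\mathbb N}$ be a coding sequence and $\mathbb X(s)$ the associated simple Toeplitz subshift, and let $p\in\mathbb N$ be commensurate with $s$. Let $\Omega(s,p)=\mathbb X(s)\times\mathbb Z_p$ with $T(x,m)=(Sx,m+1\bmod p)$, let $g:\mathcal A\times\mathbb Z_p\to\mathbb R$ and $f(x,m)=g(x_0,m)$, and for $\omega\in\Omega(s,p)$ let $H_\omega=\Delta+V_\omega$ with $V_\omega(n)=f(T^n\omega)$. Then for every $\omega\in\Omega(s,p)$, $H_\omega$ has no eigenvalues.
   Context: $S$ is the left shift, $\Delta$ the discrete Laplacian $(\Delta\psi)(n)=\psi(n+1)+\psi(n-1)$. A coding sequence is $s=(b_k,n_k)_{k}$ with $b_k\in\mathcal A$, $n_k\ge2$ integers, and $(b_k)$ not eventually constant. Define $\widetilde w_1=b_1$, $\widetilde w_{k+1}=\widetilde w_k^{n_k}b_k^{-1}b_{k+1}$ (the word $\widetilde w_k^{n_k}$ with its last letter $b_k$ replaced by $b_{k+1}$); $x(s)=\lim_k\widetilde w_k\in\mathcal A^{\mathbb N}$; $\mathbb X(s)=\{x\in\mathcal A^{\mathbb Z}:$ every finite subword of $x$ is a subword of $x(s)\}$. $p$ is commensurate with $s$ if $p$ divides $\prod_{k=1}^{k_0}n_k$ for some $k_0\in\mathbb N$. *)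

theory Defs
  imports "HOL-Analysis.Analysis"
begin

definition coding_sequence :: "real set \<Rightarrow> (nat \<Rightarrow> real) \<Rightarrow> (nat \<Rightarrow> nat) \<Rightarrow> bool" where
  "coding_sequence A b n \<longleftrightarrow>
     (\<forall>k\<ge>1. b k \<in> A) \<and> (\<forall>k\<ge>1. n k \<ge> 2) \<and>
     \<not> (\<exists>K c. \<forall>k\<ge>K. b k = c)"

fun tw :: "(nat \<Rightarrow> real) \<Rightarrow> (nat \<Rightarrow> nat) \<Rightarrow> nat \<Rightarrow> real list" where
  "tw b n 0 = []"
| "tw b n (Suc 0) = [b 1]"
| "tw b n (Suc (Suc k)) =
     butlast (concat (replicate (n (Suc k)) (tw b n (Suc k)))) @ [b (Suc (Suc k))]"

text \<open>The one-sided limit word x(s): its i-th letter is the i-th letter of any w~_k long enough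
  (the w~_k are successive prefixes of each other).\<close>
definition xs_limit :: "(nat \<Rightarrow> real) \<Rightarrow> (nat \<Rightarrow> nat) \<Rightarrow> nat \<Rightarrow> real" where
  "xs_limit b n i = (let k = (LEAST k. 1 \<le> k \<and> i < length (tw b n k)) in tw b n k ! i)"

definition toeplitz_subshift :: "(nat \<Rightarrow> real) \<Rightarrow> (nat \<Rightarrow> nat) \<Rightarrow> (int \<Rightarrow> real) set" where
  "toeplitz_subshift b n =
     {x. \<forall>m::int. \<forall>len::nat. \<exists>j::nat. \<forall>i<len. x (m + int i) = xs_limit b n (j + i)}"

definition commensurate :: "nat \<Rightarrow> (nat \<Rightarrow> nat) \<Rightarrow> bool" where
  "commensurate p n \<longleftrightarrow> (\<exists>k0::nat. p dvd (\<Prod>k=1..k0. n k))"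

text \<open>Potential V_omega(j) = f(T^j omega) = g(x_j, (m + j) mod p) for omega = (x, m).\<close>
definition potential :: "(real \<Rightarrow> int \<Rightarrow> real) \<Rightarrow> nat \<Rightarrow> (int \<Rightarrow> real) \<Rightarrow> int \<Rightarrow> int \<Rightarrow> real" where
  "potential g p x m j = g (x j) ((m + j) mod int p)"

definition is_eigenvalue :: "(int \<Rightarrow> real) \<Rightarrow> complex \<Rightarrow> bool" where
  "is_eigenvalue V E \<longleftrightarrow>
     (\<exists>\<psi>::int \<Rightarrow> complex. \<psi> \<noteq> (\<lambda>_. 0) \<and> (\<lambda>j. (norm (\<psi> j))^2) summable_on UNIV \<and>
        (\<forall>j. \<psi> (j + 1) + \<psi> (j - 1) + of_real (V j) * \<psi> j = E * \<psi> j))"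

end

theory Submission
  imports Defs
begin

text \<open>
  On the level-\<open>k\<close> holes (one residue class modulo the period \<open>N k\<close>, off which the potential is
  \<open>N k\<close>-periodic) a solution satisfies a discrete Schroedinger equation
  \<open>\<psi>(h + N k) + \<psi>(h - N k) = \<tau> \<psi>(h)\<close>, where \<open>\<tau>\<close> is the trace of the transfer matrix over one block closed
  with the letter at \<open>h\<close>; the same relation holds at any site around which the block repeats.
  After merging levels the letters \<open>v k\<close> alternate. Fix a site \<open>t\<close> with \<open>\<psi> t \<noteq> 0\<close> and look at the two
  level-\<open>k\<close> holes enclosing it, for large \<open>k\<close>.
  If they carry equal letters, a square centred at \<open>t\<close> makes the trace of \<open>v k\<close> small; a third block would
  make it large, so \<open>N (Suc k) = 3 N k\<close> and the same happens at all later levels. Then \<open>\<ell>\<^sup>2\<close> bounds the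
  sum of the squared traces, under which the trace map keeps the difference of the two traces away from \<open>0\<close>
  although both traces tend to \<open>0\<close>.
  If the letters differ for all large \<open>k\<close>, a one-sided square makes the trace of \<open>v k\<close> large at every level,
  and a maximum principle forces \<open>\<psi>\<close> to vanish on the holes. A decaying solution vanishing on the holes
  solves a periodic equation, hence is \<open>0\<close> by Gordon's argument.
\<close>

section \<open>Transfer matrices\<close>

definition tmat :: "complex \<Rightarrow> complex^2^2" where
  "tmat z = vector [vector [z, -1], vector [1, 0]]"

primrec transfer :: "(int \<Rightarrow> complex) \<Rightarrow> int \<Rightarrow> nat \<Rightarrow> complex^2^2" where
  "transfer W l 0 = mat 1"
| "transfer W l (Suc n) = tmat (W (l + int n)) ** transfer W l n"

text \<open>The energy sits inside the coefficient: \<open>W\<close> will stand for the energy minus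
  the potential, so that the eigenvalue equation becomes this recurrence.\<close>

definition solves :: "(int \<Rightarrow> complex) \<Rightarrow> (int \<Rightarrow> complex) \<Rightarrow> bool" where
  "solves W \<psi> \<longleftrightarrow> (\<forall>j. \<psi> (j + 1) + \<psi> (j - 1) = W j * \<psi> j)"

definition decaying :: "(int \<Rightarrow> complex) \<Rightarrow> bool" where
  "decaying \<psi> \<longleftrightarrow> (\<forall>e>0. \<exists>B. \<forall>j. B \<le> \<bar>j\<bar> \<longrightarrow> norm (\<psi> j) < e)"

lemma tmat_nth [simp]:
  "tmat z $ 1 $ 1 = z" "tmat z $ 1 $ 2 = -1" "tmat z $ 2 $ 1 = 1" "tmat z $ 2 $ 2 = 0"
  by (simp_all add: tmat_def)

lemma matrix_mul_2: "((A::complex^2^2) ** B) $ i $ j = A$i$1 * B$1$j + A$i$2 * B$2$j"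
  by (simp add: matrix_matrix_mult_def sum_2)

lemma trace_2: "trace (A::complex^2^2) = A$1$1 + A$2$2"
  by (simp add: trace_def sum_2)

lemma transfer_add: "transfer W l (m + n) = transfer W (l + int m) n ** transfer W l m"
  by (induction n) (simp_all add: matrix_mul_assoc add.assoc)

lemma transfer_cong:
  assumes "\<And>i. i < n \<Longrightarrow> W (l + int i) = W' (l' + int i)"
  shows "transfer W l n = transfer W' l' n"
  using assms by (induction n) simp_all

lemma det_transfer [simp]: "det (transfer W l n) = 1"
proof (induction n)
  case 0
  show ?case by simp
next
  case (Suc n)
  have "det (tmat z) = 1" for z by (simp add: det_2)
  then show ?case using Suc by (simp add: det_mul)
qed

lemma transfer_solves:
  assumes "solves W \<psi>"
  shows "\<psi> (l + int n) = transfer W l n $ 1 $ 1 * \<psi> l + transfer W l n $ 1 $ 2 * \<psi> (l - 1)"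
    and "\<psi> (l + int n - 1) = transfer W l n $ 2 $ 1 * \<psi> l + transfer W l n $ 2 $ 2 * \<psi> (l - 1)"
proof (induction n)
  case 0
  {
    case 1 show ?case by (simp add: mat_def)
  next
    case 2 show ?case by (simp add: mat_def)
  }
next
  case (Suc n)
  have e: "\<psi> (l + int n + 1) = W (l + int n) * \<psi> (l + int n) - \<psi> (l + int n - 1)"
    using assms by (metis solves_def add_diff_cancel_right')
  {
    case 1
    have "\<psi> (l + int (Suc n)) = \<psi> (l + int n + 1)"
      by (simp add: ac_simps)
    then show ?case
      unfolding e Suc.IH by (simp add: matrix_mul_2 algebra_simps)
  next
    case 2
    show ?case using Suc.IH by (simp add: matrix_mul_2)
  }
qed

text \<open>The stretches strictly between \<open>t - N\<close> and \<open>t\<close> and strictly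
  between \<open>t\<close> and \<open>t + N\<close> share one transfer matrix of determinant 1.
  Inverting the left copy expresses both far values through the values at and next to
  \<open>t\<close>, and the equation at \<open>t\<close> eliminates the neighbours.
  \<open>W t\<close> itself stays free.\<close>

lemma three_term:
  assumes sol: "solves W \<psi>" and N: "0 < N"
    and per: "\<And>j. t - int N < j \<Longrightarrow> j < t \<Longrightarrow> W (j + int N) = W j"
  shows "\<psi> (t + int N) + \<psi> (t - int N) = trace (tmat (W t) ** transfer W (t + 1) (N - 1)) * \<psi> t"
proof -
  define Q where "Q = transfer W (t + 1) (N - 1)"
  have Q': "transfer W (t - int N + 1) (N - 1) = Q"
    unfolding Q_def
  proof (rule transfer_cong)
    fix i assume "i < N - 1"
    then show "W (t - int N + 1 + int i) = W (t + 1 + int i)"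
      using per [of "t - int N + 1 + int i"] by (simp add: algebra_simps)
  qed
  have N1: "int (N - 1) = int N - 1" using N by auto
  have 1: "\<psi> (t + int N) = Q$1$1 * \<psi> (t + 1) + Q$1$2 * \<psi> t"
    using transfer_solves(1) [OF sol, of "t + 1" "N - 1"] unfolding Q_def [symmetric] N1 by simp
  have 2: "\<psi> t = Q$1$1 * \<psi> (t - int N + 1) + Q$1$2 * \<psi> (t - int N)"
    using transfer_solves(1) [OF sol, of "t - int N + 1" "N - 1"] unfolding Q' N1 by simp
  have 3: "\<psi> (t - 1) = Q$2$1 * \<psi> (t - int N + 1) + Q$2$2 * \<psi> (t - int N)"
    using transfer_solves(2) [OF sol, of "t - int N + 1" "N - 1"] unfolding Q' N1 by simp
  have d: "Q$1$1 * Q$2$2 - Q$1$2 * Q$2$1 = 1"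
    using det_transfer [of W "t+1" "N - 1"] by (simp add: Q_def det_2)
  have 4: "\<psi> (t - int N) = Q$1$1 * \<psi> (t - 1) - Q$2$1 * \<psi> t"
    using 2 3 d by algebra
  have 5: "\<psi> (t + 1) + \<psi> (t - 1) = W t * \<psi> t"
    using sol by (simp add: solves_def)
  show ?thesis
    unfolding Q_def [symmetric] using 1 4 5
    by (simp add: trace_2 matrix_mul_2) algebra
qed

section \<open>Decay of square-summable solutions and Gordon's argument\<close>

lemma summable_on_imp_decaying:
  fixes \<psi> :: "int \<Rightarrow> complex"
  assumes "(\<lambda>j. (norm (\<psi> j))^2) summable_on UNIV"
  shows "decaying \<psi>"
  unfolding decaying_def
proof (intro allI impI)
  fix e :: real assume e: "e > 0"
  let ?S = "{j. e \<le> norm (\<psi> j)}"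
  have fin: "finite ?S"
  proof (rule ccontr)
    assume "infinite ?S"
    then obtain f :: "nat \<Rightarrow> int" where f: "inj f" "range f \<subseteq> ?S"
      by (meson infinite_countable_subset)
    have "(\<lambda>j. (norm (\<psi> j))^2) summable_on range f"
      using assms summable_on_subset_banach by blast
    then have "((\<lambda>j. (norm (\<psi> j))^2) \<circ> f) summable_on UNIV"
      using summable_on_reindex [OF f(1)] by blast
    then have "summable ((\<lambda>j. (norm (\<psi> j))^2) \<circ> f)"
      by (rule summable_on_imp_summable)
    then have "(\<lambda>k. (norm (\<psi> (f k)))^2) \<longlonglongrightarrow> 0"
      using summable_LIMSEQ_zero by (force simp: o_def)
    then have "\<forall>\<^sub>F k in sequentially. (norm (\<psi> (f k)))^2 < e^2"
      by (rule order_tendstoD) (use e in simp)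
    then obtain k where "(norm (\<psi> (f k)))^2 < e^2"
      using eventually_happens' sequentially_bot by blast
    moreover have "e \<le> norm (\<psi> (f k))" using f(2) by auto
    ultimately show False using e by (meson less_le_not_le norm_ge_zero power_less_imp_less_base)
  qed
  define B where "B = Max (insert 0 (abs ` ?S)) + 1"
  have "\<bar>j\<bar> < B" if "j \<in> ?S" for j
    using that fin unfolding B_def by (simp add: zle_add1_eq_le)
  then show "\<exists>B. \<forall>j. B \<le> \<bar>j\<bar> \<longrightarrow> norm (\<psi> j) < e"
    by (intro exI [of _ B]) (force simp: not_le)
qed

text \<open>Gordon's three-block argument, applied to a large multiple of the period.\<close>

lemma periodic_no_decaying_solution:
  assumes sol: "solves W \<psi>" and dec: "decaying \<psi>" and N: "0 < N"
    and per: "\<And>j. W (j + int N) = W j"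
  shows "\<psi> t = 0"
proof (rule ccontr)
  assume t: "\<psi> t \<noteq> 0"
  define a where "a = norm (\<psi> t)"
  have a: "a > 0" using t by (simp add: a_def)
  then obtain B where B: "\<And>j. B \<le> \<bar>j\<bar> \<Longrightarrow> norm (\<psi> j) < a/4"
    using dec by (metis decaying_def zero_less_divide_iff zero_less_numeral)
  \<comment> \<open>Chosen so that \<open>t + M\<close>, \<open>t - M\<close> and
    \<open>t + 2 M\<close> all have absolute value at least \<open>B\<close>.\<close>
  define m where "m = nat (\<bar>B\<bar> + \<bar>t\<bar> + 1)"
  define M where "M = m * N"
  have "m \<le> M" using N by (simp add: M_def)
  then have M: "int M \<ge> \<bar>B\<bar> + \<bar>t\<bar> + 1" unfolding m_def by linarith
  then have M0: "0 < M" by linarith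
  have perM: "W (j + int M) = W j" for j
    unfolding M_def
  proof (induction m)
    case (Suc m)
    have "W (j + int (Suc m * N)) = W (j + int (m * N) + int N)" by (simp add: algebra_simps)
    then show ?case using Suc by (simp add: per)
  qed simp
  define \<tau> where "\<tau> = trace (tmat (W t) ** transfer W (t + 1) (M - 1))"
  have 1: "\<psi> (t + int M) + \<psi> (t - int M) = \<tau> * \<psi> t"
    unfolding \<tau>_def using three_term [OF sol M0] perM by blast
  have "transfer W (t + int M + 1) (M - 1) = transfer W (t + 1) (M - 1)"
  proof (rule transfer_cong)
    fix i
    show "W (t + int M + 1 + int i) = W (t + 1 + int i)"
      using perM [of "t + 1 + int i"] by (simp add: algebra_simps)
  qed
  then have 2: "\<psi> (t + int M + int M) + \<psi> t = \<tau> * \<psi> (t + int M)"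
    using three_term [OF sol M0, of "t + int M"] perM by (simp add: \<tau>_def)
  have b: "norm (\<psi> (t + int M)) < a/4" "norm (\<psi> (t - int M)) < a/4"
      "norm (\<psi> (t + int M + int M)) < a/4"
    using M by (intro B; linarith)+
  have "norm \<tau> * a \<le> norm (\<psi> (t + int M)) + norm (\<psi> (t - int M))"
    unfolding a_def norm_mult [symmetric] 1 [symmetric] by (rule norm_triangle_ineq)
  then have "norm \<tau> * a < 1 * a" using b a by linarith
  then have "norm \<tau> < 1" using a mult_less_cancel_right_pos by blast
  then have "norm (\<tau> * \<psi> (t + int M)) \<le> norm (\<psi> (t + int M))"
    unfolding norm_mult by (simp add: mult_left_le_one_le)
  moreover have "a \<le> norm (\<tau> * \<psi> (t + int M)) + norm (\<psi> (t + int M + int M))"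
    unfolding a_def using 2 norm_triangle_ineq4 [of "\<tau> * \<psi> (t + int M)" "\<psi> (t + int M + int M)"]
    by (metis add_diff_cancel_left')
  ultimately show False using b a by linarith
qed

section \<open>Potentials of Toeplitz type\<close>

definition hole_at :: "(nat \<Rightarrow> nat) \<Rightarrow> (nat \<Rightarrow> int) \<Rightarrow> nat \<Rightarrow> int \<Rightarrow> bool" where
  "hole_at N c k j \<longleftrightarrow> int (N k) dvd j - c k"

text \<open>What remains of the subshift after merging levels: level \<open>k\<close> writes
  \<open>v k\<close> into those of its holes that are not holes of level \<open>Suc k\<close>. The
  values \<open>v k\<close> already contain the energy and the phase modulo \<open>p\<close>, which
  will be constant on the holes.\<close>

locale toeplitz_potential =
  fixes W :: "int \<Rightarrow> complex" and N :: "nat \<Rightarrow> nat" and c :: "nat \<Rightarrow> int" and v :: "nat \<Rightarrow> complex"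
  assumes N_pos: "0 < N k"
    and N_dvd: "N k dvd N (Suc k)"
    and N_grow: "2 * N k \<le> N (Suc k)"
    and center: "int (N k) dvd c (Suc k) - c k"
    and per: "\<not> hole_at N c k j \<Longrightarrow> W (j + int (N k)) = W j"
    and letter: "hole_at N c k j \<Longrightarrow> \<not> hole_at N c (Suc k) j \<Longrightarrow> W j = v k"
    and two_letters: "hole_at N c k j \<Longrightarrow> W j = v k \<or> W j = v (Suc k)"
    and alternate: "v (Suc (Suc k)) = v k"
    and v_neq: "v (Suc k) \<noteq> v k"
begin

abbreviation hole :: "nat \<Rightarrow> int \<Rightarrow> bool" where
  "hole \<equiv> hole_at N c"

lemma hole_add [simp]: "hole k (j + int (N k)) = hole k j"
proof -
  have "j + int (N k) - c k = (j - c k) + int (N k)" by simp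
  then show ?thesis unfolding hole_at_def by (metis dvd_add_left_iff dvd_refl)
qed

lemma hole_diff [simp]: "hole k (j - int (N k)) = hole k j"
  using hole_add [of k "j - int (N k)"] by simp

lemma hole_c [simp]: "hole k (c k)"
  by (simp add: hole_at_def)

lemma hole_Suc:
  assumes "hole (Suc k) j"
  shows "hole k j"
proof -
  have "int (N k) dvd j - c (Suc k)"
    using assms N_dvd [of k] unfolding hole_at_def by (metis dvd_trans int_dvd_int_iff)
  from dvd_add [OF this center [of k]] show ?thesis
    by (simp add: hole_at_def)
qed

lemma hole_dvd: "hole k i \<Longrightarrow> hole k j \<Longrightarrow> int (N k) dvd i - j"
  unfolding hole_at_def using dvd_diff [of "int (N k)" "i - c k" "j - c k"] by simp

lemma hole_unique:
  assumes "hole k i" "hole k j" "\<bar>i - j\<bar> < int (N k)"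
  shows "i = j"
  using hole_dvd [OF assms(1,2)] assms(3) zdvd_imp_le [of "int (N k)" "\<bar>i - j\<bar>"]
  by fastforce

lemma hole_add_mult [simp]: "hole k (j + int m * int (N k)) = hole k j"
proof (induction m)
  case (Suc m)
  then show ?case using hole_add [of k "j + int m * int (N k)"] by (simp add: algebra_simps)
qed simp

lemma per_mult: "\<not> hole k j \<Longrightarrow> W (j + int m * int (N k)) = W j"
proof (induction m)
  case (Suc m)
  then show ?case
    using per [of k "j + int m * int (N k)"] by (simp add: algebra_simps)
qed simp

lemma per_dvd:
  assumes "\<not> hole k i" "int (N k) dvd i - j"
  shows "W i = W j"
proof -
  obtain q where q: "i - j = int (N k) * q" using assms(2) by (elim dvdE)
  have nj: "\<not> hole k j"
    using assms dvd_add [of "int (N k)" "i - j" "j - c k"] unfolding hole_at_def by auto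
  show ?thesis
  proof (cases "q \<ge> 0")
    case True
    then have "i = j + int (nat q) * int (N k)" using q by (simp add: algebra_simps)
    then show ?thesis by (metis per_mult nj)
  next
    case False
    then have "j = i + int (nat (- q)) * int (N k)" using q by (simp add: algebra_simps)
    then show ?thesis by (metis per_mult assms(1))
  qed
qed

text \<open>The hole is left out of the block, so that \<open>tau k z\<close> is the trace over a
  full period whichever letter \<open>z\<close> fills the hole.\<close>

definition Q :: "nat \<Rightarrow> complex^2^2" where
  "Q k = transfer W (c k + 1) (N k - 1)"

definition tau :: "nat \<Rightarrow> complex \<Rightarrow> complex" where
  "tau k z = trace (tmat z ** Q k)"

lemma det_Q [simp]: "det (Q k) = 1"
  by (simp add: Q_def)

lemma transfer_hole:
  assumes "hole k h"
  shows "transfer W (h + 1) (N k - 1) = Q k"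
  unfolding Q_def
proof (rule transfer_cong)
  fix i assume i: "i < N k - 1"
  have "\<not> hole k (h + 1 + int i)"
    using hole_unique [OF _ assms, of "h + 1 + int i"] i by fastforce
  moreover have "int (N k) dvd (h + 1 + int i) - (c k + 1 + int i)"
    using assms by (simp add: hole_at_def)
  ultimately show "W (h + 1 + int i) = W (c k + 1 + int i)"
    by (rule per_dvd)
qed

text \<open>A window of length \<open>N k\<close> contains exactly one level-\<open>k\<close> hole.
  Cutting the product there and rotating it cyclically, which keeps the trace, leaves one block
  closed with the letter of that hole.\<close>

lemma trace_window:
  assumes z: "\<And>h. hole k h \<Longrightarrow> s \<le> h \<Longrightarrow> h < s + int (N k) \<Longrightarrow> W h = z"
  shows "trace (tmat (W s) ** transfer W (s + 1) (N k - 1)) = tau k z"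
proof -
  define i where "i = nat ((c k - s) mod int (N k))"
  define h where "h = s + int i"
  have i: "int i = (c k - s) mod int (N k)" "i < N k"
    using N_pos [of k] by (simp_all add: i_def nat_less_iff)
  have "h - c k = - ((c k - s) - (c k - s) mod int (N k))"
    unfolding h_def i(1) by simp
  then have h: "hole k h"
    unfolding hole_at_def by (metis dvd_minus_iff dvd_minus_mod)
  have Wh: "W h = z" using z [OF h] i(2) by (simp add: h_def)
  show ?thesis
  proof (cases "i = 0")
    case True
    then show ?thesis
      using transfer_hole [OF h] Wh by (simp add: h_def tau_def)
  next
    case False
    define X where "X = transfer W (h + 1) (N k - 1 - i)"
    define Y where "Y = transfer W (s + 1) (i - 1)"
    have i1: "int (i - 1) = int i - 1" using False by auto
    have 1: "transfer W (s + 1) (N k - 1) = X ** (tmat z ** Y)"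
    proof -
      have "transfer W (s + 1) (N k - 1) = transfer W (s + 1) (Suc (i - 1) + (N k - 1 - i))"
        using False i(2) by simp
      also have "\<dots> = X ** (tmat z ** Y)"
        unfolding transfer_add transfer.simps X_def Y_def h_def i1
        using False Wh by (simp add: h_def add_ac)
      finally show ?thesis .
    qed
    \<comment> \<open>The stretch before the hole \<open>h\<close> reappears one period later, where
      it completes the block that starts behind \<open>h\<close>.\<close>
    have "Y ** tmat (W s) = transfer W s (1 + (i - 1))"
      unfolding transfer_add by (simp add: Y_def)
    also have "\<dots> = transfer W (s + int (N k)) i"
    proof -
      have "transfer W s i = transfer W (s + int (N k)) i"
      proof (rule transfer_cong)
        fix l assume "l < i"
        then have "\<not> hole k (s + int l)"
          using hole_unique [OF _ h, of "s + int l"] i(2) by (auto simp: h_def)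
        from per [OF this] show "W (s + int l) = W (s + int (N k) + int l)"
          by (simp add: ac_simps)
      qed
      then show ?thesis using False by simp
    qed
    finally have 2: "Y ** tmat (W s) = transfer W (s + int (N k)) i" .
    have "Q k = transfer W (h + 1) ((N k - 1 - i) + i)"
      using transfer_hole [OF h] i(2) by simp
    also have "\<dots> = transfer W (s + int (N k)) i ** X"
      unfolding transfer_add using i(2) by (simp add: X_def h_def of_nat_diff)
    finally have 3: "Q k = Y ** tmat (W s) ** X" by (simp add: 2)
    have "trace (tmat (W s) ** (X ** (tmat z ** Y))) = trace ((tmat (W s) ** X) ** (tmat z ** Y))"
      by (simp add: matrix_mul_assoc)
    also have "\<dots> = trace ((tmat z ** Y) ** (tmat (W s) ** X))" by (rule trace_mul_sym)
    also have "\<dots> = tau k z" by (simp add: tau_def 3 matrix_mul_assoc)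
    finally show ?thesis unfolding 1 .
  qed
qed

text \<open>A common letter on the holes near \<open>s\<close> makes \<open>W\<close> repeat across
  one period there, holes included, so the three-term relation applies and its window can be rotated
  to a hole.\<close>

lemma hole_relation:
  assumes sol: "solves W \<psi>"
    and z: "\<And>h. hole k h \<Longrightarrow> s - int (N k) < h \<Longrightarrow> h < s + int (N k) \<Longrightarrow> W h = z"
  shows "\<psi> (s + int (N k)) + \<psi> (s - int (N k)) = tau k z * \<psi> s"
proof -
  have "W (j + int (N k)) = W j" if "s - int (N k) < j" "j < s" for j
  proof (cases "hole k j")
    case True
    then show ?thesis using z [of j] z [of "j + int (N k)"] that by simp
  qed (rule per)
  then have "\<psi> (s + int (N k)) + \<psi> (s - int (N k)) =
      trace (tmat (W s) ** transfer W (s + 1) (N k - 1)) * \<psi> s"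
    using three_term [OF sol N_pos] by blast
  also have "trace (tmat (W s) ** transfer W (s + 1) (N k - 1)) = tau k z"
    using z N_pos [of k] by (intro trace_window) auto
  finally show ?thesis .
qed

lemma hole_relation_at_hole:
  assumes "solves W \<psi>" "hole k h"
  shows "\<psi> (h + int (N k)) + \<psi> (h - int (N k)) = tau k (W h) * \<psi> h"
proof (rule hole_relation [OF assms(1)])
  fix i assume "hole k i" "h - int (N k) < i" "i < h + int (N k)"
  then have "i = h" using hole_unique [OF _ assms(2)] by (simp add: abs_less_iff)
  then show "W i = W h" by simp
qed

text \<open>The values of \<open>W\<close> on the holes do not enter the equation for such a
  \<open>\<psi>\<close>; replacing them by 0 makes the coefficient
  \<open>N k\<close>-periodic.\<close>

lemma vanishes_on_holes:
  assumes sol: "solves W \<psi>" and dec: "decaying \<psi>"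
    and zero: "\<And>h. hole k h \<Longrightarrow> \<psi> h = 0"
  shows "\<psi> t = 0"
proof (rule periodic_no_decaying_solution [of "\<lambda>j. if hole k j then 0 else W j" \<psi> "N k"])
  show "solves (\<lambda>j. if hole k j then 0 else W j) \<psi>"
    using sol zero by (simp add: solves_def)
qed (use dec N_pos per in auto)

lemma N_ge: "k < N k"
proof (induction k)
  case (Suc k)
  then show ?case using N_grow [of k] by linarith
qed (rule N_pos)


end

section \<open>The trace dichotomy\<close>

text \<open>Write M for \<open>tmat a ** X\<close>. Cayley-Hamilton gives M^2 = s M - 1. Since
  \<open>tmat z\<close> times the inverse of \<open>tmat a\<close> has trace 2, the trace of
  \<open>tmat z ** X ** M\<close> is s times that of \<open>tmat z ** X\<close>, minus 2.\<close>

lemma trace_cube: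
  assumes "det (X::complex^2^2) = 1" and s: "s = trace (tmat a ** X)"
  shows "trace (tmat z ** (X ** tmat a ** X ** tmat a ** X)) = (s^2 - 1) * trace (tmat z ** X) - 2 * s"
proof -
  have "X$1$1 * X$2$2 - X$1$2 * X$2$1 = 1"
    using assms(1) by (simp add: det_2)
  then show ?thesis
    unfolding s by (simp add: trace_2 matrix_mul_2) algebra
qed

text \<open>From \<open>M\<close> on, \<open>D\<close> keeps at least the product of the factors 1 -
  q, which is at least 1 minus a tail sum of \<open>q\<close>, hence at least 1/2. As
  \<open>D\<close> tends to 0, this forces \<open>D M = 0\<close>.\<close>

lemma product_bounded_below:
  fixes D q :: "nat \<Rightarrow> real"
  assumes q: "summable q" "\<And>k. 0 \<le> q k" and D: "\<And>k. 0 \<le> D k" "D \<longlonglongrightarrow> 0"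
    and step: "\<And>k. K \<le> k \<Longrightarrow> (1 - q k) * D k \<le> D (Suc k)"
  obtains k where "K \<le> k" "D k = 0"
proof -
  obtain M0 where M0: "\<And>n. n \<ge> M0 \<Longrightarrow> norm (\<Sum>i. q (i + n)) < 1/2"
    using suminf_exist_split [OF _ q(1), of "1/2"] by auto
  define M where "M = max K M0"
  have "(\<Sum>i<m. q (i + M)) \<le> (\<Sum>i. q (i + M))" for m
    using q by (intro sum_le_suminf) (auto simp: summable_iff_shift)
  moreover have "(\<Sum>i. q (i + M)) < 1/2"
    using M0 [of M] by (simp add: M_def)
  ultimately have S: "(\<Sum>i<m. q (i + M)) \<le> 1/2" for m
    by (meson less_eq_real_def order_le_less_trans)
  have low: "(1 - (\<Sum>i<m. q (i + M))) * D M \<le> D (m + M)" for m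
  proof (induction m)
    case (Suc m)
    let ?S = "\<Sum>i<m. q (i + M)"
    have q1: "q (m + M) \<le> 1"
    proof -
      have "q (m + M) \<le> (\<Sum>i<Suc m. q (i + M))" using q(2) by (simp add: sum_nonneg)
      then show ?thesis using S [of "Suc m"] by linarith
    qed
    have "0 \<le> ?S" using q(2) by (simp add: sum_nonneg)
    then have "(1 - (?S + q (m + M))) * D M \<le> ((1 - q (m + M)) * (1 - ?S)) * D M"
      using q(2) D(1) by (intro mult_right_mono) (auto simp: algebra_simps)
    also have "\<dots> \<le> (1 - q (m + M)) * D (m + M)"
      using mult_left_mono [OF Suc.IH, of "1 - q (m + M)"] q1 by (simp add: mult.assoc)
    also have "\<dots> \<le> D (Suc (m + M))"
      by (rule step) (simp add: M_def)
    finally show ?case by simp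
  qed simp
  have "D M / 2 \<le> D (m + M)" for m
  proof -
    have "1/2 * D M \<le> (1 - (\<Sum>i<m. q (i + M))) * D M"
      using S [of m] D(1) by (intro mult_right_mono) auto
    then show ?thesis using low [of m] by simp
  qed
  moreover have "(\<lambda>m. D (m + M)) \<longlonglongrightarrow> 0" using D(2) by (rule LIMSEQ_ignore_initial_segment)
  ultimately have "D M / 2 \<le> 0" by (intro LIMSEQ_le_const) auto
  then show thesis using D(1) [of M] that [of M] by (simp add: M_def)
qed

text \<open>The setting of an indirect proof: \<open>contradiction\<close> derives
  \<open>False\<close> from these assumptions.\<close>

locale eigenfunction = toeplitz_potential +
  fixes \<psi> :: "int \<Rightarrow> complex" and t :: int
  assumes sol: "solves W \<psi>"
    and square_summable: "(\<lambda>j. (norm (\<psi> j))^2) summable_on UNIV"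
    and nz: "\<psi> t \<noteq> 0"
begin

section \<open>The holes enclosing \<open>t\<close> and the trace relations around it\<close>

lemma dec: "decaying \<psi>"
  using square_summable by (rule summable_on_imp_decaying)

text \<open>The consecutive level-\<open>k\<close> holes with \<open>L k < t \<le> R k\<close>.\<close>

definition R :: "nat \<Rightarrow> int" where
  "R k = t + (c k - t) mod int (N k)"

definition L :: "nat \<Rightarrow> int" where
  "L k = R k - int (N k)"

definition p :: "nat \<Rightarrow> complex" where
  "p k = tau k (v k)"

definition symm :: "nat \<Rightarrow> bool" where
  "symm k \<longleftrightarrow> W (L k) = W (R k)"

lemma hole_R [simp]: "hole k (R k)"
proof -
  have "R k - c k = - ((c k - t) - (c k - t) mod int (N k))"
    unfolding R_def by simp
  then show ?thesis
    unfolding hole_at_def by (metis dvd_minus_iff dvd_minus_mod)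
qed

lemma hole_L [simp]: "hole k (L k)"
  by (simp add: L_def)

lemma LR_bounds: "t \<le> R k" "R k < t + int (N k)" "t - int (N k) \<le> L k" "L k < t" "R k = L k + int (N k)"
  using N_pos [of k] by (simp_all add: R_def L_def)

lemma R_eq: "hole k h \<Longrightarrow> t \<le> h \<Longrightarrow> h < t + int (N k) \<Longrightarrow> R k = h"
  using LR_bounds [of k] by (intro hole_unique [of k]) auto

lemma L_eq: "hole k h \<Longrightarrow> t - int (N k) \<le> h \<Longrightarrow> h < t \<Longrightarrow> L k = h"
  using LR_bounds [of k] by (intro hole_unique [of k]) auto

lemma not_both_Suc_hole: "\<not> (hole (Suc k) (L k) \<and> hole (Suc k) (R k))"
  using hole_unique [of "Suc k" "R k" "L k"] LR_bounds(5) [of k] N_grow [of k] N_pos [of k] by auto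

lemma Suc_hole: "hole k h \<Longrightarrow> W h \<noteq> v k \<Longrightarrow> hole (Suc k) h"
  using letter by blast

text \<open>Of two neighbouring level-\<open>k\<close> holes at least one does not survive to level
  \<open>Suc k\<close>. That one carries \<open>v k\<close>, and by symmetry so does the
  other.\<close>

lemma symm_letter: "symm k \<Longrightarrow> W (R k) = v k"
  using not_both_Suc_hole [of k] Suc_hole [of k "L k"] Suc_hole [of k "R k"] by (auto simp: symm_def)

lemma symm_relation: "symm k \<Longrightarrow> \<psi> (t + int (N k)) + \<psi> (t - int (N k)) = p k * \<psi> t"
  unfolding p_def
proof (rule hole_relation [OF sol])
  fix h assume s: "symm k" and h: "hole k h" "t - int (N k) < h" "h < t + int (N k)"
  then have "h = L k \<or> h = R k" using L_eq [of k h] R_eq [of k h] by linarith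
  then show "W h = v k" using s symm_letter [OF s] by (auto simp: symm_def)
qed

text \<open>The relation is centred at \<open>t + N k\<close>, where only \<open>R k\<close> and its
  right neighbour are in range. Now \<open>\<psi> t\<close> is an outer value, which forces the
  trace to be large instead of small.\<close>

lemma right_relation:
  assumes "W (R k) = v k" "W (R k + int (N k)) = v k"
  shows "\<psi> (t + 2 * int (N k)) + \<psi> t = p k * \<psi> (t + int (N k))"
proof -
  have "\<psi> (t + int (N k) + int (N k)) + \<psi> (t + int (N k) - int (N k)) = p k * \<psi> (t + int (N k))"
    unfolding p_def
  proof (rule hole_relation [OF sol])
    fix h assume h: "hole k h" "t + int (N k) - int (N k) < h" "h < t + int (N k) + int (N k)"
    then have "h = R k \<or> h = R k + int (N k)"
      using R_eq [of k h] R_eq [of k "h - int (N k)"] hole_diff [of k h] by force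
    then show "W h = v k" using assms by auto
  qed
  then show ?thesis by (simp add: add.assoc)
qed

lemma left_relation:
  assumes "W (L k) = v k" "W (L k - int (N k)) = v k"
  shows "\<psi> t + \<psi> (t - 2 * int (N k)) = p k * \<psi> (t - int (N k))"
proof -
  have "\<psi> (t - int (N k) + int (N k)) + \<psi> (t - int (N k) - int (N k)) = p k * \<psi> (t - int (N k))"
    unfolding p_def
  proof (rule hole_relation [OF sol])
    fix h assume h: "hole k h" "t - int (N k) - int (N k) < h" "h < t - int (N k) + int (N k)"
    then have "h = L k \<or> h = L k - int (N k)"
      using L_eq [of k h] L_eq [of k "h + int (N k)"] hole_add [of k h] by force
    then show "W h = v k" using assms by auto
  qed
  then show ?thesis by (simp add: diff_diff_eq)
qed

section \<open>Trace sizes forced by squares near \<open>t\<close>\<close>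

definition small :: "nat \<Rightarrow> bool" where
  "small k \<longleftrightarrow> (\<forall>j. int (N k) \<le> \<bar>j - t\<bar> \<longrightarrow> norm (\<psi> j) < norm (\<psi> t) / 4)"

lemma eventually_small: "\<exists>K. \<forall>k\<ge>K. small k"
proof -
  obtain B where B: "\<And>j. B \<le> \<bar>j\<bar> \<Longrightarrow> norm (\<psi> j) < norm (\<psi> t) / 4"
    using dec nz by (metis decaying_def zero_less_divide_iff zero_less_norm_iff zero_less_numeral)
  have "small k" if "nat (\<bar>B\<bar> + \<bar>t\<bar>) \<le> k" for k
    unfolding small_def
  proof (intro allI impI)
    fix j assume "int (N k) \<le> \<bar>j - t\<bar>"
    then show "norm (\<psi> j) < norm (\<psi> t) / 4"
      using that N_ge [of k] by (intro B) linarith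
  qed
  then show ?thesis by blast
qed

lemma small_norms:
  assumes "small k"
  shows "norm (\<psi> (t + int (N k))) < norm (\<psi> t) / 4" "norm (\<psi> (t - int (N k))) < norm (\<psi> t) / 4"
    "norm (\<psi> (t + 2 * int (N k))) < norm (\<psi> t) / 4" "norm (\<psi> (t - 2 * int (N k))) < norm (\<psi> t) / 4"
  using assms by (auto simp: small_def)

text \<open>With a the norm of \<open>\<psi> t\<close>, the relation gives a < (norm (p k) + 1) a /
  4. The resulting 3 exceeds both the bound 1 from a centred square and the 2 needed for the maximum
  principle.\<close>

lemma one_sided_square_trace:
  assumes "y2 + \<psi> t = p k * y1" "norm y1 < norm (\<psi> t) / 4" "norm y2 < norm (\<psi> t) / 4"
  shows "3 < norm (p k)"
proof -
  have "norm (\<psi> t) \<le> norm (p k) * norm y1 + norm y2"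
    unfolding norm_mult [symmetric] assms(1) [symmetric]
    by (metis add_diff_cancel_left' norm_triangle_ineq4)
  moreover have "norm (p k) * norm y1 \<le> norm (p k) * (norm (\<psi> t) / 4)"
    using assms(2) by (intro mult_left_mono) auto
  ultimately have "3 * norm (\<psi> t) < norm (p k) * norm (\<psi> t)"
    using assms(3) by simp
  then show ?thesis
    using mult_less_cancel_right_pos nz zero_less_norm_iff by blast
qed

lemma symm_trace_small:
  assumes "small k" "symm k"
  shows "norm (p k) < 1"
proof -
  have "norm (p k) * norm (\<psi> t) \<le> norm (\<psi> (t + int (N k))) + norm (\<psi> (t - int (N k)))"
    using norm_triangle_ineq [of "\<psi> (t + int (N k))" "\<psi> (t - int (N k))"]
    unfolding symm_relation [OF assms(2)] norm_mult .
  then have "norm (p k) * norm (\<psi> t) < 1 * norm (\<psi> t)"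
    using small_norms [OF assms(1)] norm_ge_zero [of "\<psi> t"] by linarith
  then show ?thesis
    using mult_less_cancel_right_pos nz zero_less_norm_iff by blast
qed

text \<open>If the next hole on either side carried \<open>v k\<close>, a one-sided square would
  contradict the small trace. Hence both carry the other letter and survive to level
  \<open>Suc k\<close>. They are \<open>3 * N k\<close> apart, so the ratio of the periods divides
  3, and they are the new enclosing holes, with equal letters.\<close>

lemma symm_Suc:
  assumes "small k" "symm k"
  shows "N (Suc k) = 3 * N k" "symm (Suc k)"
proof -
  have p1: "norm (p k) < 1" using assms by (rule symm_trace_small)
  have WR: "W (R k) = v k" and WL: "W (L k) = v k"
    using symm_letter [OF assms(2)] assms(2) by (simp_all add: symm_def)
  have WR': "W (R k + int (N k)) \<noteq> v k"
    using one_sided_square_trace [OF right_relation] small_norms [OF assms(1)] WR p1 by fastforce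
  have WL': "W (L k - int (N k)) \<noteq> v k"
    using one_sided_square_trace [of "\<psi> (t - 2 * int (N k))" k "\<psi> (t - int (N k))"]
      left_relation [of k] small_norms [OF assms(1)] WL p1 by (force simp: add.commute)
  have hR: "hole (Suc k) (R k + int (N k))" and hL: "hole (Suc k) (L k - int (N k))"
    using WR' WL' by (auto intro!: Suc_hole)
  have "R k + int (N k) - (L k - int (N k)) = int (3 * N k)"
    using LR_bounds(5) [of k] by simp
  then have "int (N (Suc k)) dvd int (3 * N k)"
    using hole_dvd [OF hR hL] by simp
  then have d: "N (Suc k) dvd 3 * N k" by (simp only: int_dvd_int_iff)
  obtain q where q: "N (Suc k) = q * N k" by (metis N_dvd dvdE mult.commute)
  have "q dvd 3" using d N_pos [of k] by (simp add: q)
  moreover have "2 \<le> q" using N_grow [of k] N_pos [of k] by (simp add: q)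
  moreover have "q \<noteq> 2" using \<open>q dvd 3\<close> by (auto simp: dvd_def) presburger
  ultimately have "q = 3" using dvd_imp_le [of q 3] by simp
  then show N3: "N (Suc k) = 3 * N k" by (simp add: q)
  have "R (Suc k) = R k + int (N k)"
    using hR LR_bounds [of k] by (intro R_eq) (auto simp: N3)
  moreover have "L (Suc k) = L k - int (N k)"
    using hL LR_bounds [of k] by (intro L_eq) (auto simp: N3)
  ultimately show "symm (Suc k)"
    using WR' WL' two_letters [of k "R k + int (N k)"] two_letters [of k "L k - int (N k)"]
    by (simp add: symm_def)
qed

text \<open>The enclosing hole without \<open>v k\<close> survives and encloses \<open>t\<close> at
  level \<open>Suc k\<close> too; as that level is also mixed, the opposite new hole carries
  \<open>v k\<close>. On that side the adjacent level-\<open>k\<close> hole and the one beyond it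
  therefore both carry \<open>v k\<close>: were the farther one different, it would itself be the
  new hole. This gives a one-sided square.\<close>

lemma mixed_trace_large:
  assumes "small k" "\<not> symm k" "\<not> symm (Suc k)"
  shows "3 < norm (p k)"
proof (cases "W (R k) = v k")
  case False
  then have h: "hole (Suc k) (R k)" by (intro Suc_hole) auto
  then have RS: "R (Suc k) = R k"
    using LR_bounds [of k] N_grow [of k] by (intro R_eq) auto
  have "W (R k) = v (Suc k)" using False two_letters [of k "R k"] by simp
  then have LS: "W (L (Suc k)) = v k"
    using assms(3) two_letters [of "Suc k" "L (Suc k)"] by (auto simp: symm_def RS alternate)
  have 1: "W (L k) = v k"
    using h not_both_Suc_hole [of k] Suc_hole [of k "L k"] by auto
  have 2: "W (L k - int (N k)) = v k"
  proof (rule ccontr)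
    assume ne: "W (L k - int (N k)) \<noteq> v k"
    then have "hole (Suc k) (L k - int (N k))" by (intro Suc_hole) auto
    then have "L (Suc k) = L k - int (N k)"
      using LR_bounds [of k] N_grow [of k] by (intro L_eq) auto
    then show False using LS ne by simp
  qed
  show ?thesis
    using one_sided_square_trace [of "\<psi> (t - 2 * int (N k))" k "\<psi> (t - int (N k))"]
      left_relation [OF 1 2] small_norms [OF assms(1)] by (simp add: add.commute)
next
  case True
  then have "W (L k) \<noteq> v k" using assms(2) by (simp add: symm_def)
  then have h: "hole (Suc k) (L k)" by (intro Suc_hole) auto
  then have LS: "L (Suc k) = L k"
    using LR_bounds [of k] N_grow [of k] by (intro L_eq) auto
  have "W (L k) = v (Suc k)" using \<open>W (L k) \<noteq> v k\<close> two_letters [of k "L k"] by simp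
  then have RS: "W (R (Suc k)) = v k"
    using assms(3) two_letters [of "Suc k" "R (Suc k)"] by (auto simp: symm_def LS alternate)
  have 2: "W (R k + int (N k)) = v k"
  proof (rule ccontr)
    assume ne: "W (R k + int (N k)) \<noteq> v k"
    then have "hole (Suc k) (R k + int (N k))" by (intro Suc_hole) auto
    then have "R (Suc k) = R k + int (N k)"
      using LR_bounds [of k] N_grow [of k] by (intro R_eq) auto
    then show False using RS ne by simp
  qed
  show ?thesis
    using one_sided_square_trace [OF right_relation [OF True 2]] small_norms [OF assms(1)] by simp
qed

text \<open>Maximum principle on the level-\<open>k\<close> holes: the two letters are handled by the three-term relations
  of levels \<open>k\<close> and \<open>Suc k\<close>.\<close>

lemma not_both_traces_large: "\<not> (2 < norm (p k) \<and> 2 < norm (p (Suc k)))"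
proof
  assume large: "2 < norm (p k) \<and> 2 < norm (p (Suc k))"
  have "\<psi> h0 = 0" if h0: "hole k h0" for h0
  proof (rule ccontr)
    assume nz0: "\<psi> h0 \<noteq> 0"
    \<comment> \<open>Decay makes this set finite, so the norm of \<open>\<psi>\<close> attains its
      maximum over all level-\<open>k\<close> holes.\<close>
    let ?X = "{j. hole k j \<and> norm (\<psi> h0) \<le> norm (\<psi> j)}"
    obtain B where B: "\<And>j. B \<le> \<bar>j\<bar> \<Longrightarrow> norm (\<psi> j) < norm (\<psi> h0)"
      using dec nz0 by (metis decaying_def zero_less_norm_iff)
    have "?X \<subseteq> {- \<bar>B\<bar>..\<bar>B\<bar>}"
    proof
      fix j assume "j \<in> ?X"
      then have "\<not> B \<le> \<bar>j\<bar>" using B [of j] by auto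
      then show "j \<in> {- \<bar>B\<bar>..\<bar>B\<bar>}" by auto
    qed
    then have fin: "finite ?X" using finite_subset by blast
    have ne: "?X \<noteq> {}" using h0 by auto
    define M where "M = Max ((\<lambda>j. norm (\<psi> j)) ` ?X)"
    have "M \<in> (\<lambda>j. norm (\<psi> j)) ` ?X" unfolding M_def using fin ne by (intro Max_in) auto
    then obtain h where h: "hole k h" "norm (\<psi> h0) \<le> norm (\<psi> h)" "M = norm (\<psi> h)" by auto
    have max: "norm (\<psi> j) \<le> norm (\<psi> h)" if "hole k j" for j
    proof (cases "norm (\<psi> h0) \<le> norm (\<psi> j)")
      case True
      then have "norm (\<psi> j) \<le> M" unfolding M_def using fin that by (intro Max_ge) auto
      then show ?thesis by (simp add: h)
    qed (use h in simp)
    \<comment> \<open>The level is chosen by the letter at the maximum. A hole carrying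
      \<open>v (Suc k)\<close> is also a hole of level \<open>Suc k\<close>, and its neighbours at
      that level are still level-\<open>k\<close> holes.\<close>
    obtain l where l: "hole l h" "W h = v l" "2 < norm (p l)"
      "hole k (h + int (N l))" "hole k (h - int (N l))"
    proof (cases "W h = v k")
      case True
      then show thesis using that [of k] h large by simp
    next
      case False
      then have "hole (Suc k) h" "W h = v (Suc k)"
        using Suc_hole two_letters [of k h] h(1) by auto
      then show thesis
        using that [of "Suc k"] large hole_Suc [of k "h + int (N (Suc k))"]
          hole_Suc [of k "h - int (N (Suc k))"] by simp
    qed
    have "norm (p l) * norm (\<psi> h) \<le> norm (\<psi> (h + int (N l))) + norm (\<psi> (h - int (N l)))"
      using norm_triangle_ineq [of "\<psi> (h + int (N l))" "\<psi> (h - int (N l))"]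
      unfolding hole_relation_at_hole [OF sol l(1)] l(2) p_def norm_mult .
    then have "norm (p l) * norm (\<psi> h) \<le> 2 * norm (\<psi> h)"
      using max [OF l(4)] max [OF l(5)] by linarith
    moreover have "norm (\<psi> h) > 0" using h(2) nz0 by (smt (verit) zero_less_norm_iff)
    ultimately show False using l(3) by simp
  qed
  then show False using vanishes_on_holes [OF sol dec] nz by blast
qed

text \<open>Between consecutive holes of level \<open>Suc k\<close> lie exactly two
  level-\<open>k\<close> holes. Neither survives, so both carry \<open>v k\<close>.\<close>

lemma Q_triple:
  assumes N3: "N (Suc k) = 3 * N k"
  shows "Q (Suc k) = Q k ** tmat (v k) ** Q k ** tmat (v k) ** Q k"
proof -
  define h where "h = c (Suc k)"
  have h: "hole (Suc k) h" by (simp add: h_def)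
  have W1: "W (h + int (N k)) = v k"
  proof (rule letter)
    show "\<not> hole (Suc k) (h + int (N k))"
      using hole_unique [OF _ h, of "h + int (N k)"] N3 N_pos [of k] by auto
  qed (use h in \<open>simp add: hole_Suc\<close>)
  have W2: "W (h + int (N k) + int (N k)) = v k"
  proof (rule letter)
    show "\<not> hole (Suc k) (h + int (N k) + int (N k))"
      using hole_unique [OF _ h, of "h + int (N k) + int (N k)"] N3 N_pos [of k] by auto
  qed (use hole_Suc [OF h] in \<open>simp only: hole_add\<close>)
  have block: "transfer W (i + 1) (N k - 1) = Q k" if "hole k i" for i
    using that by (rule transfer_hole)
  have hk: "hole k h" using h by (rule hole_Suc)
  have step: "transfer W (i + 1) (N k + m) =
      transfer W (i + int (N k) + 1) m ** (tmat (W (i + int (N k))) ** Q k)" if "hole k i" for i m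
  proof -
    have "transfer W (i + 1) (N k + m) = transfer W (i + 1) (Suc (N k - 1) + m)"
      using N_pos [of k] by simp
    also have "\<dots> = transfer W (i + int (N k) + 1) m ** (tmat (W (i + int (N k))) ** Q k)"
      unfolding transfer_add transfer.simps block [OF that]
      using N_pos [of k] by (simp add: of_nat_diff algebra_simps)
    finally show ?thesis .
  qed
  have "Q (Suc k) = transfer W (h + 1) (N k + (N k + (N k - 1)))"
  proof -
    have "N (Suc k) - 1 = N k + (N k + (N k - 1))" using N_pos [of k] by (simp add: N3)
    then show ?thesis by (simp only: Q_def h_def)
  qed
  also have "\<dots> = Q k ** (tmat (v k) ** Q k) ** (tmat (v k) ** Q k)"
    using hk by (simp only: step block W1 W2 hole_add)
  finally show ?thesis by (simp add: matrix_mul_assoc)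
qed

lemma tau_triple:
  assumes "N (Suc k) = 3 * N k"
  shows "tau (Suc k) z = ((p k)^2 - 1) * tau k z - 2 * p k"
  unfolding tau_def [of "Suc k"] Q_triple [OF assms]
  by (subst trace_cube [OF det_Q refl]) (simp add: tau_def p_def)

text \<open>Otherwise the upper left entry of \<open>Q k\<close> vanishes, and \<open>\<psi>\<close> is geometric along the holes.\<close>

lemma trace_difference_nonzero: "tau k (v k) \<noteq> tau k (v (Suc k))"
proof
  assume "tau k (v k) = tau k (v (Suc k))"
  then have "(v k - v (Suc k)) * Q k $ 1 $ 1 = 0"
    by (simp add: tau_def trace_2 matrix_mul_2 algebra_simps)
  then have Q11: "Q k $ 1 $ 1 = 0" using v_neq [of k] by auto
  define b where "b = Q k $ 1 $ 2"
  have "b \<noteq> 0" using det_Q [of k] Q11 by (auto simp: det_2 b_def)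
  have step: "\<psi> (h + int (N k)) = b * \<psi> h" if "hole k h" for h
    using transfer_solves(1) [OF sol, of "h + 1" "N k - 1"] N_pos [of k]
    unfolding transfer_hole [OF that] by (simp add: Q11 b_def of_nat_diff)
  have power: "\<psi> (h + int m * int (N k)) = b ^ m * \<psi> h" if "hole k h" for h m
  proof (induction m)
    case (Suc m)
    then show ?case using step [of "h + int m * int (N k)"] that
      by (simp add: algebra_simps)
  qed simp
  have "\<psi> h = 0" if h: "hole k h" for h
  proof (rule ccontr)
    assume "\<psi> h \<noteq> 0"
    then obtain B where B: "\<And>j. B \<le> \<bar>j\<bar> \<Longrightarrow> norm (\<psi> j) < norm (\<psi> h)"
      using dec by (metis decaying_def zero_less_norm_iff)
    define m where "m = nat (\<bar>B\<bar> + \<bar>h\<bar>)"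
    have "m \<le> m * N k" using N_pos [of k] by simp
    then have m: "\<bar>B\<bar> + \<bar>h\<bar> \<le> int m * int (N k)"
      unfolding m_def by (metis abs_ge_zero add_nonneg_nonneg int_nat_eq of_nat_mono of_nat_mult)
    show False
    proof (cases "1 \<le> norm b")
      case True
      have "norm (\<psi> h) \<le> norm (b ^ m * \<psi> h)"
        using True by (simp add: norm_mult norm_power mult_le_cancel_right1)
      then show False
        using B [of "h + int m * int (N k)"] m unfolding power [OF h] by linarith
    next
      case False
      \<comment> \<open>A ratio of norm below 1 means growth to the left, so the decay is
        contradicted on that side.\<close>
      define h' where "h' = h - int m * int (N k)"
      have "hole k h'" using h hole_add_mult [of k h' m] by (simp add: h'_def)
      then have "\<psi> h = b ^ m * \<psi> h'" using power [of h' m] by (simp add: h'_def)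
      then have "norm (\<psi> h) \<le> norm (\<psi> h')"
        using False by (simp add: norm_mult norm_power mult_left_le_one_le power_le_one)
      then show False using B [of h'] m unfolding h'_def by linarith
    qed
  qed
  then show False using vanishes_on_holes [OF sol dec] nz by blast
qed

section \<open>Square-summability against the trace map\<close>

lemma summable_translates:
  assumes "inj f"
  shows "summable (\<lambda>k::nat. (norm (\<psi> (f k)))^2)"
proof -
  have "(\<lambda>j. (norm (\<psi> j))^2) summable_on range f"
    using square_summable summable_on_subset_banach by blast
  then have "((\<lambda>j. (norm (\<psi> j))^2) \<circ> f) summable_on UNIV"
    using summable_on_reindex [OF assms] by blast
  then show ?thesis
    using summable_on_imp_summable by (fastforce simp: o_def)
qed

lemma N_inj: "inj N"
proof (rule strict_mono_imp_inj_on)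
  show "strict_mono N"
    unfolding strict_mono_Suc_iff
  proof
    fix k show "N k < N (Suc k)" using N_grow [of k] N_pos [of k] by linarith
  qed
qed

text \<open>The trace map multiplies the difference of the two traces by 1 - (p k)^2. The centred
  squares make the squares of the \<open>p k\<close> summable, so these factors cannot bring a
  nonzero difference to 0. Yet both traces tend to 0, and the difference never vanishes.\<close>

lemma not_eventually_symm: "\<not> (\<forall>k\<ge>K. symm k \<and> N (Suc k) = 3 * N k)"
proof
  assume A: "\<forall>k\<ge>K. symm k \<and> N (Suc k) = 3 * N k"
  define q where "q k = tau k (v (Suc k))" for k
  have p_Suc: "p (Suc k) = ((p k)^2 - 1) * q k - 2 * p k" if "K \<le> k" for k
    using tau_triple [of k "v (Suc k)"] A that by (simp add: p_def q_def)
  \<comment> \<open>The letters alternate, so the second trace at level \<open>Suc k\<close> is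
    computed from the first trace at level \<open>k\<close>.\<close>
  have q_Suc: "q (Suc k) = (p k)^3 - 3 * p k" if "K \<le> k" for k
    using tau_triple [of k "v k"] A that
    by (simp add: p_def [symmetric] q_def alternate power2_eq_square power3_eq_cube algebra_simps)
  define D where "D k = norm (p k - q k)" for k
  \<comment> \<open>Cut off below \<open>K\<close>, where no centred square is available, so that
    the comparison holds for every index.\<close>
  define s where "s k = (if K \<le> k then (norm (p k))^2 else 0)" for k
  define C where "C = 2 / (norm (\<psi> t))^2"
  have s_le: "s k \<le> C * ((norm (\<psi> (t + int (N k))))^2 + (norm (\<psi> (t - int (N k))))^2)" for k
  proof (cases "K \<le> k")
    case True
    let ?x = "norm (\<psi> (t + int (N k)))" and ?y = "norm (\<psi> (t - int (N k)))"
    have "norm (p k * \<psi> t) \<le> ?x + ?y"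
      using norm_triangle_ineq [of "\<psi> (t + int (N k))" "\<psi> (t - int (N k))"] A True
      by (simp add: symm_relation)
    then have "(norm (p k) * norm (\<psi> t))^2 \<le> (?x + ?y)^2"
      by (intro power_mono) (auto simp: norm_mult)
    also have "\<dots> \<le> 2 * (?x^2 + ?y^2)"
      using sum_squares_bound [of ?x ?y] by (simp add: power2_sum)
    finally have "(norm (p k))^2 * (norm (\<psi> t))^2 \<le> 2 * (?x^2 + ?y^2)"
      by (simp add: power_mult_distrib)
    then have "(norm (p k))^2 \<le> 2 * (?x^2 + ?y^2) / (norm (\<psi> t))^2"
      using nz by (simp add: pos_le_divide_eq)
    then show ?thesis
      using True by (simp add: s_def C_def)
  qed (simp add: s_def C_def)
  have "inj (\<lambda>k. t + int (N k))" "inj (\<lambda>k. t - int (N k))"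
    using N_inj by (simp_all add: inj_on_def)
  then have "summable (\<lambda>k. C * ((norm (\<psi> (t + int (N k))))^2 + (norm (\<psi> (t - int (N k))))^2))"
    by (intro summable_mult summable_add summable_translates)
  then have s_sum: "summable s"
    by (rule summable_comparison_test' [where N = 0]) (use s_le in \<open>auto simp: s_def\<close>)
  have "(\<lambda>k. sqrt (s k)) \<longlonglongrightarrow> 0"
    using tendsto_real_sqrt [OF summable_LIMSEQ_zero [OF s_sum]] by simp
  moreover have "\<forall>\<^sub>F k in sequentially. sqrt (s k) = norm (p k)"
    using eventually_ge_at_top [of K] by eventually_elim (simp add: s_def)
  ultimately have "(\<lambda>k. norm (p k)) \<longlonglongrightarrow> 0"
    by (rule Lim_transform_eventually)
  then have p0: "p \<longlonglongrightarrow> 0" by (simp add: tendsto_norm_zero_iff)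
  \<comment> \<open>The recursion for \<open>p (Suc k)\<close> solved for \<open>q k\<close>:
    convergence of \<open>p\<close> to 0 passes to the other trace.\<close>
  have "(\<lambda>k. (p (Suc k) + 2 * p k) / ((p k)^2 - 1)) \<longlonglongrightarrow> (0 + 2 * 0) / (0^2 - 1)"
    using p0 by (intro tendsto_intros) (auto simp: filterlim_sequentially_Suc)
  moreover have "\<forall>\<^sub>F k in sequentially. (p (Suc k) + 2 * p k) / ((p k)^2 - 1) = q k"
  proof -
    have "\<forall>\<^sub>F k in sequentially. norm (p k) < 1"
      using p0 by (auto simp: tendsto_iff dist_norm dest: spec [of _ 1])
    then show ?thesis
      using eventually_ge_at_top [of K]
    proof eventually_elim
      case (elim k)
      then have "(p k)^2 \<noteq> 1"
        by (metis less_irrefl norm_one norm_power power2_eq_1_iff norm_minus_cancel)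
      then show ?case using p_Suc [of k] elim by (simp add: field_simps)
    qed
  qed
  ultimately have "q \<longlonglongrightarrow> (0 + 2 * 0) / (0^2 - 1)"
    by (rule Lim_transform_eventually)
  then have "D \<longlonglongrightarrow> 0"
    unfolding D_def using tendsto_norm [OF tendsto_diff [OF p0]] by fastforce
  moreover have "(1 - s k) * D k \<le> D (Suc k)" if "K \<le> k" for k
  proof -
    have "p (Suc k) - q (Suc k) = (1 - (p k)^2) * (p k - q k)"
      unfolding p_Suc [OF that] q_Suc [OF that]
      by (simp add: power2_eq_square power3_eq_cube algebra_simps)
    then have "D (Suc k) = norm (1 - (p k)^2) * D k" by (simp add: D_def norm_mult)
    moreover have "1 - s k \<le> norm (1 - (p k)^2)"
      using norm_triangle_ineq2 [of 1 "(p k)^2"] that by (simp add: s_def norm_power)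
    ultimately show ?thesis by (simp add: D_def mult_right_mono)
  qed
  ultimately obtain k where "D k = 0"
    by (rule product_bounded_below [OF s_sum, of D K, rotated 2]) (auto simp: s_def D_def)
  then show False
    using trace_difference_nonzero [of k] by (simp add: D_def p_def q_def)
qed

lemma contradiction: False
proof -
  obtain K where K: "\<And>k. K \<le> k \<Longrightarrow> small k" using eventually_small by blast
  show False
  proof (cases "\<exists>k\<ge>K. symm k")
    case True
    then obtain k0 where k0: "K \<le> k0" "symm k0" by blast
    have "symm k" if "k0 \<le> k" for k
      using that
    proof (induction k rule: dec_induct)
      case (step k)
      then show ?case using K k0 by (intro symm_Suc(2)) auto
    qed (rule k0)
    then show False
      using not_eventually_symm [of k0] symm_Suc(1) K k0(1) by (meson order_trans)
  next
    case False
    then have "3 < norm (p k)" if "K \<le> k" for k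
      using that K by (intro mixed_trace_large) auto
    from this [of K] this [of "Suc K"] show False
      using not_both_traces_large [of K] by simp
  qed
qed

end

section \<open>Simple Toeplitz subshifts\<close>

text \<open>Used to find the level at which a site is filled, namely the last one at which it is
  still a hole.\<close>

lemma last_true:
  assumes "P (k::nat)" "\<not> P l" "k \<le> l"
  obtains j where "k \<le> j" "j < l" "P j" "\<not> P (Suc j)"
proof -
  have "\<exists>j. k \<le> j \<and> j < l \<and> P j \<and> \<not> P (Suc j)"
    using assms(3,2)
  proof (induction l rule: dec_induct)
    case base
    then show ?case using assms(1) by simp
  next
    case (step l)
    then show ?case by (cases "P l") (auto intro: less_SucI)
  qed
  then show thesis using that by blast
qed

lemma nth_concat_replicate:
  "i < m * length xs \<Longrightarrow> concat (replicate m xs) ! i = xs ! (i mod length xs)"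
proof (induction m arbitrary: i)
  case (Suc m)
  show ?case
  proof (cases "i < length xs")
    case False
    then show ?thesis
      using Suc.IH [of "i - length xs"] Suc.prems by (simp add: nth_append le_mod_geq)
  qed (simp add: nth_append)
qed simp

text \<open>Indexed so that \<open>period n k\<close> is the length of \<open>tw b n k\<close> for
  positive \<open>k\<close>. The empty product at \<open>k = 1\<close> makes every site a hole of
  level 1.\<close>

definition period :: "(nat \<Rightarrow> nat) \<Rightarrow> nat \<Rightarrow> nat" where
  "period n k = (\<Prod>i=1..<k. n i)"

context
  fixes b :: "nat \<Rightarrow> real" and n :: "nat \<Rightarrow> nat"
  assumes n2: "\<And>k. 1 \<le> k \<Longrightarrow> 2 \<le> n k"
begin

lemma period_1 [simp]: "period n (Suc 0) = 1"
  by (simp add: period_def)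

lemma period_Suc: "1 \<le> k \<Longrightarrow> period n (Suc k) = n k * period n k"
  by (simp add: period_def atLeastLessThanSuc)

lemma period_pos [simp]: "0 < period n k"
  unfolding period_def by (rule prod_pos) (use n2 in fastforce)

lemma period_dvd: "k \<le> l \<Longrightarrow> period n k dvd period n l"
  unfolding period_def by (intro prod_dvd_prod_subset) auto

lemma period_less: "1 \<le> k \<Longrightarrow> k < l \<Longrightarrow> 2 * period n k \<le> period n l"
proof -
  assume k: "1 \<le> k" "k < l"
  have "2 * period n k \<le> period n (Suc k)"
    using n2 [OF k(1)] by (simp add: period_Suc [OF k(1)])
  also have "\<dots> \<le> period n l"
    using k by (intro dvd_imp_le [OF period_dvd]) auto
  finally show ?thesis .
qed

lemma period_ge: "1 \<le> k \<Longrightarrow> k \<le> period n k"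
proof (induction k rule: dec_induct)
  case (step k)
  then show ?case using period_less [of k "Suc k"] by simp
qed simp

lemma length_tw: "1 \<le> k \<Longrightarrow> length (tw b n k) = period n k"
proof (induction k rule: dec_induct)
  case (step k)
  then obtain k' where "k = Suc k'" by (metis Suc_le_D One_nat_def)
  then show ?case
    using step period_pos [of "Suc k"] by (simp add: length_concat sum_list_replicate period_Suc)
qed simp

text \<open>With positions counted from 1, the letter is determined by the last level whose period
  divides the position. Passing from \<open>k\<close> to \<open>Suc k\<close> repeats the word and
  changes only the final letter, so other positions reduce modulo \<open>period n k\<close>; the end
  of an inner copy keeps the letter \<open>b k\<close>.\<close>

lemma tw_nth:
  assumes "1 \<le> k" "i < period n k" "1 \<le> j" "period n j dvd i + 1" "\<not> period n (Suc j) dvd i + 1"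
  shows "tw b n k ! i = b j"
  using assms
proof (induction k arbitrary: i j rule: dec_induct)
  case base
  then have "i = 0" by simp
  then have "period n j = 1" using base by simp
  then have "j = 1" using base period_less [of 1 j] by (cases "j = 1") auto
  then show ?case using \<open>i = 0\<close> by simp
next
  case (step k)
  obtain k' where k': "k = Suc k'" using step.hyps by (metis Suc_le_D One_nat_def)
  let ?w = "concat (replicate (n k) (tw b n k))"
  have len: "length ?w = period n (Suc k)"
    using step.hyps by (simp add: length_concat sum_list_replicate length_tw period_Suc)
  have tw_Suc: "tw b n (Suc k) = butlast ?w @ [b (Suc k)]" by (simp add: k')
  have j_ge: "l \<le> j" if "period n l dvd i + 1" for l
  proof (rule ccontr)
    assume "\<not> l \<le> j"
    then have "period n (Suc j) dvd period n l" by (intro period_dvd) simp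
    then show False using that step.prems dvd_trans by blast
  qed
  have j_le: "j \<le> Suc k"
  proof (rule ccontr)
    assume "\<not> j \<le> Suc k"
    then have "2 * period n (Suc k) \<le> period n j" by (intro period_less) auto
    then show False using step.prems dvd_imp_le [of "period n j" "i + 1"] by simp
  qed
  show ?case
  proof (cases "i + 1 = period n (Suc k)")
    case True
    then have "j = Suc k" using j_ge [of "Suc k"] j_le by simp
    moreover have "i = length (butlast ?w)" using True len by simp
    ultimately show ?thesis unfolding tw_Suc by (simp only: nth_append_length)
  next
    case False
    then have i: "i < length (butlast ?w)" using len step.prems by simp
    have "tw b n (Suc k) ! i = ?w ! i"
      unfolding tw_Suc using i by (simp add: nth_append nth_butlast)
    also have "\<dots> = tw b n k ! (i mod period n k)"
      using step.prems step.hyps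
      by (subst nth_concat_replicate) (auto simp: length_tw period_Suc)
    also have "\<dots> = b j"
    proof (cases "period n k dvd i + 1")
      case True
      have "j < Suc k"
      proof (rule ccontr)
        assume "\<not> j < Suc k"
        then have "period n (Suc k) dvd i + 1"
          using period_dvd [of "Suc k" j] step.prems dvd_trans by (metis not_less)
        then show False
          using False step.prems dvd_imp_le [of "period n (Suc k)" "i + 1"] by simp
      qed
      then have j: "j = k" using j_ge [OF True] by simp
      have im: "i mod period n k + 1 = period n k"
        using True by (metis Suc_eq_plus1 dvd_eq_mod_eq_0 mod_Suc nat.distinct(1))
      have "\<not> period n (Suc k) dvd period n k"
      proof
        assume "period n (Suc k) dvd period n k"
        then have "period n (Suc k) \<le> period n k" by (rule dvd_imp_le) simp
        then show False using period_less [of k "Suc k"] step.hyps period_pos [of k] by simp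
      qed
      then show ?thesis
        unfolding j using step.IH [of "i mod period n k" k] step.hyps im by simp
    next
      case False
      have jk: "j < k"
      proof (rule ccontr)
        assume "\<not> j < k"
        then show False using period_dvd [of k j] step.prems False dvd_trans by (metis not_less)
      qed
      have eq: "i + 1 = (i div period n k) * period n k + (i mod period n k + 1)"
        by (simp only: add.assoc [symmetric] div_mult_mod_eq)
      have "period n l dvd i + 1 \<longleftrightarrow> period n l dvd i mod period n k + 1" if "l \<le> k" for l
        by (subst eq, rule dvd_add_right_iff) (simp add: period_dvd [OF that])
      then show ?thesis
        using jk step.prems by (intro step.IH) auto
    qed
    finally show ?thesis .
  qed
qed

text \<open>The formula of \<open>tw_nth\<close> does not depend on the level, so the least
  sufficient level chosen by \<open>xs_limit\<close> gives the same letter as any other.\<close>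

lemma xs_limit_eq:
  assumes "1 \<le> j" "period n j dvd i + 1" "\<not> period n (Suc j) dvd i + 1"
  shows "xs_limit b n i = b j"
proof -
  define k where "k = (LEAST k. 1 \<le> k \<and> i < length (tw b n k))"
  have "1 \<le> Suc i \<and> i < length (tw b n (Suc i))"
    using period_ge [of "Suc i"] by (simp add: length_tw)
  then have "1 \<le> k \<and> i < length (tw b n k)"
    unfolding k_def by (rule LeastI)
  then have "1 \<le> k" "i < period n k" using length_tw by auto
  then show ?thesis
    using tw_nth assms unfolding xs_limit_def k_def [symmetric] Let_def by blast
qed

lemma xs_limit_letter: "\<exists>k\<ge>1. xs_limit b n i = b k"
proof -
  have "\<not> period n (Suc (Suc i)) dvd i + 1"
    using period_ge [of "Suc (Suc i)"] by (auto dest: dvd_imp_le)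
  then obtain j where "1 \<le> j" "period n j dvd i + 1" "\<not> period n (Suc j) dvd i + 1"
    using last_true [of "\<lambda>k. period n k dvd i + 1" 1 "Suc (Suc i)"] by auto
  then show ?thesis using xs_limit_eq by blast
qed

section \<open>Hole structure of the subshift elements\<close>

text \<open>A subshift element is a limit of translates of the one-sided word, so its holes of level \<open>k\<close> come from
  a residue modulo \<open>period n k\<close> shared by infinitely many of these translates.\<close>

lemma toeplitz_subshift_structure:
  assumes "x \<in> toeplitz_subshift b n"
  obtains c where "\<And>k. int (period n k) dvd c (Suc k) - c k"
    and "\<And>k j. 1 \<le> k \<Longrightarrow> int (period n k) dvd j - c k \<Longrightarrow>
      \<not> int (period n (Suc k)) dvd j - c (Suc k) \<Longrightarrow> x j = b k"
    and "\<And>j. \<exists>k\<ge>1. x j = b k"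
proof -
  \<comment> \<open>The window of radius \<open>M\<close> around 0 is found in the one-sided word.
    Site \<open>j\<close> sits at position \<open>e + j\<close> counted from 1, hence at index
    \<open>e + j - 1\<close>; the bound on \<open>e\<close> keeps this nonnegative.\<close>
  have "\<exists>e::int. int M < e \<and> (\<forall>j. \<bar>j\<bar> \<le> int M \<longrightarrow> x j = xs_limit b n (nat (e + j - 1)))" for M
  proof -
    obtain q where q: "\<And>i. i < 2 * M + 1 \<Longrightarrow> x (- int M + int i) = xs_limit b n (q + i)"
      using assms unfolding toeplitz_subshift_def by blast
    have "x j = xs_limit b n (nat (int (q + M + 1) + j - 1))" if "\<bar>j\<bar> \<le> int M" for j
    proof -
      have "q + nat (j + int M) = nat (int (q + M + 1) + j - 1)" using that by linarith
      moreover have "nat (j + int M) < 2 * M + 1" using that by linarith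
      moreover have "- int M + int (nat (j + int M)) = j" using that by linarith
      ultimately show ?thesis using q [of "nat (j + int M)"] by simp
    qed
    then show ?thesis by (intro exI [of _ "int (q + M + 1)"]) auto
  qed
  then obtain e :: "nat \<Rightarrow> int" where e: "\<And>M. int M < e M"
      and ex: "\<And>M j. \<bar>j\<bar> \<le> int M \<Longrightarrow> x j = xs_limit b n (nat (e M + j - 1))"
    by metis
  \<comment> \<open>Infinitely many windows whose offsets agree modulo \<open>period n k\<close>. By
    pigeonhole these sets can be chosen nested, and \<open>c k\<close> will be minus the common
    residue.\<close>
  let ?P = "\<lambda>k S. infinite S \<and> (\<exists>r. \<forall>M\<in>S. int (period n k) dvd e M + r)"
  have refine: "\<exists>S'. ?P k S' \<and> S' \<subseteq> S" if "infinite S" for S k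
  proof -
    have "(\<lambda>M. e M mod int (period n k)) ` S \<subseteq> {0..<int (period n k)}" by auto
    then have "finite ((\<lambda>M. e M mod int (period n k)) ` S)"
      using finite_subset finite_atLeastLessThan_int by blast
    from pigeonhole_infinite [OF that this] obtain M0
      where M0: "infinite {M\<in>S. e M mod int (period n k) = e M0 mod int (period n k)}"
      by blast
    have "int (period n k) dvd e M + - e M0"
      if "e M mod int (period n k) = e M0 mod int (period n k)" for M
      using that by (simp add: mod_eq_dvd_iff)
    then have "?P k {M\<in>S. e M mod int (period n k) = e M0 mod int (period n k)}"
      using M0 by blast
    then show ?thesis by blast
  qed
  obtain I where I: "\<And>k. ?P k (I k)" "\<And>k. I (Suc k) \<subseteq> I k"
  proof -
    have "\<exists>I. \<forall>k. ?P k (I k) \<and> I (Suc k) \<subseteq> I k"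
      by (rule dependent_nat_choice) (use refine [of UNIV 0] refine in blast)+
    then show thesis using that by blast
  qed
  then obtain c where c: "\<And>k M. M \<in> I k \<Longrightarrow> int (period n k) dvd e M + c k"
    by metis
  show thesis
  proof
    fix k
    obtain M where M: "M \<in> I (Suc k)" using I(1) [of "Suc k"] by fastforce
    have "int (period n k) dvd e M + c (Suc k)"
      using c [OF M] period_dvd [of k "Suc k"] by (meson dvd_trans int_dvd_int_iff le_SucI order_refl)
    moreover have "int (period n k) dvd e M + c k" using c I(2) M by blast
    ultimately have "int (period n k) dvd (e M + c (Suc k)) - (e M + c k)" by (rule dvd_diff)
    then show "int (period n k) dvd c (Suc k) - c k" by simp
  next
    fix k j
    assume k: "1 \<le> k" and hole: "int (period n k) dvd j - c k"
      and not: "\<not> int (period n (Suc k)) dvd j - c (Suc k)"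
    \<comment> \<open>An infinite set of windows contains one large enough to cover the site
      \<open>j\<close>.\<close>
    obtain M where M: "M \<in> I (Suc k)" "nat \<bar>j\<bar> \<le> M"
      using I(1) [of "Suc k"] by (meson infinite_nat_iff_unbounded_le)
    define i where "i = nat (e M + j - 1)"
    have i: "int (i + 1) = e M + j" using e [of M] M(2) by (simp add: i_def)
    have "M \<in> I k" using I(2) M(1) by blast
    from dvd_add [OF c [OF this] hole] have "int (period n k) dvd int (i + 1)"
      unfolding i by simp
    then have "period n k dvd i + 1" by (simp only: int_dvd_int_iff)
    moreover have "\<not> period n (Suc k) dvd i + 1"
    proof
      assume "period n (Suc k) dvd i + 1"
      then have "int (period n (Suc k)) dvd e M + j" using i by (metis int_dvd_int_iff)
      then have "int (period n (Suc k)) dvd (e M + j) - (e M + c (Suc k))"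
        using c [OF M(1)] by (rule dvd_diff)
      then show False using not by simp
    qed
    ultimately have "xs_limit b n i = b k" using k by (intro xs_limit_eq)
    then show "x j = b k" using ex [of j M] M(2) by (simp add: i_def)
  next
    fix j
    have "x j = xs_limit b n (nat (e (nat \<bar>j\<bar>) + j - 1))" by (rule ex) simp
    then show "\<exists>k\<ge>1. x j = b k" using xs_limit_letter by metis
  qed
qed


section \<open>Reduction of the eigenvalue equation to the abstract setting\<close>

lemma no_eigenvalue:
  fixes x :: "int \<Rightarrow> real" and g :: "real \<Rightarrow> int \<Rightarrow> real"
  assumes A: "card A = 2" "\<And>k. 1 \<le> k \<Longrightarrow> b k \<in> A"
    and not_const: "\<not> (\<exists>K c. \<forall>k\<ge>K. b k = c)"
    and p: "p dvd period n k0" "1 \<le> k0"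
    and x: "x \<in> toeplitz_subshift b n"
  shows "\<not> is_eigenvalue (potential g p x m) E"
proof
  assume "is_eigenvalue (potential g p x m) E"
  then obtain \<psi> where nz: "\<psi> \<noteq> (\<lambda>_. 0)" and l2: "(\<lambda>j. (norm (\<psi> j))^2) summable_on UNIV"
    and eq: "\<And>j. \<psi> (j + 1) + \<psi> (j - 1) + of_real (potential g p x m j) * \<psi> j = E * \<psi> j"
    unfolding is_eigenvalue_def by blast
  obtain t where t: "\<psi> t \<noteq> 0" using nz by auto
  define W where "W j = E - complex_of_real (potential g p x m j)" for j
  have sol: "solves W \<psi>"
    unfolding solves_def W_def using eq by (simp add: algebra_simps eq_diff_eq)
  obtain c where center: "\<And>k. int (period n k) dvd c (Suc k) - c k"
    and letter: "\<And>k j. 1 \<le> k \<Longrightarrow> int (period n k) dvd j - c k \<Longrightarrow>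
      \<not> int (period n (Suc k)) dvd j - c (Suc k) \<Longrightarrow> x j = b k"
    and letters: "\<And>j. \<exists>k\<ge>1. x j = b k"
    using toeplitz_subshift_structure [OF x] by blast
  have xA: "x j \<in> A" for j using letters [of j] A(2) by auto
  have center_le: "int (period n k) dvd c l - c k" if "k \<le> l" for k l
    using that
  proof (induction l rule: dec_induct)
    case (step l)
    have "int (period n k) dvd c (Suc l) - c l"
      using center [of l] period_dvd [OF step.hyps(1)] by (meson dvd_trans int_dvd_int_iff)
    from dvd_add [OF this step.IH] show ?case by simp
  qed simp

  \<comment> \<open>Levels with equal consecutive letters are merged by keeping only the start of each run.\<close>
  define S where "S = {k. k0 < k \<and> b k \<noteq> b (k - 1)}"
  have S_inf: "infinite S"
    unfolding infinite_nat_iff_unbounded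
  proof (rule allI, rule ccontr)
    fix M assume no: "\<not> (\<exists>k>M. k \<in> S)"
    have "b k = b (max M k0)" if "max M k0 \<le> k" for k
      using that
    proof (induction k rule: dec_induct)
      case (step k)
      then have "Suc k \<notin> S" using no by auto
      then show ?case using step by (auto simp: S_def)
    qed simp
    then show False using not_const by blast
  qed
  define K where "K = enumerate S"
  have K_S: "K i \<in> S" for i unfolding K_def by (rule enumerate_in_set [OF S_inf])
  have K_Suc: "K i < K (Suc i)" for i unfolding K_def by (rule enumerate_step [OF S_inf])
  have K_ge: "k0 < K i" "1 \<le> K i" for i using K_S [of i] p(2) by (auto simp: S_def)
  have K_gap: "b l = b (K i)" if "K i \<le> l" "l < K (Suc i)" for i l
    using that
  proof (induction l rule: dec_induct)
    case (step l)
    have "Suc l \<notin> S"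
    proof
      assume "Suc l \<in> S"
      then have "K (Suc i) \<le> Suc l"
        unfolding K_def enumerate_Suc'' [OF S_inf]
        using step.hyps by (intro Least_le) (simp add: K_def)
      then show False using step.prems by simp
    qed
    then show ?case using step K_ge(1) [of i] by (simp add: S_def)
  qed simp
  have b_neq: "b (K (Suc i)) \<noteq> b (K i)" for i
  proof -
    have "b (K (Suc i) - 1) = b (K i)" using K_Suc [of i] by (intro K_gap) auto
    then show ?thesis using K_S [of "Suc i"] by (auto simp: S_def)
  qed
  have binary: "z = a \<or> z = a'" if "a \<in> A" "a' \<in> A" "z \<in> A" "a \<noteq> a'" for a a' z
    using A(1) that by (auto simp: card_2_iff)
  have bA: "b (K i) \<in> A" for i using A(2) K_ge(2) by blast

  define N where "N i = period n (K i)" for i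
  define d where "d i = c (K i)" for i
  define r where "r = (m + c k0) mod int p"
  define v where "v i = E - complex_of_real (g (b (K i)) r)" for i
  \<comment> \<open>This is why \<open>S\<close> keeps only levels beyond \<open>k0\<close>: there
    the periods are multiples of \<open>p\<close>, so the phase is constant on the holes and
    unchanged by a shift by the period.\<close>
  have p_dvd: "int p dvd int (period n k)" if "k0 \<le> k" for k
    using p(1) period_dvd [OF that] by (meson dvd_trans int_dvd_int_iff)
  have per: "W (j + int (N i)) = W j" if "\<not> hole_at N d i j" for i j
  proof -
    let ?P = "\<lambda>j l. int (period n l) dvd j - c l"
    \<comment> \<open>Every site is a hole of level 1, so a site that is no hole at
      \<open>K i\<close> was filled at some earlier level \<open>l\<close>, and a shift by
      \<open>N i\<close> preserves this.\<close>
    have "?P j 1" "\<not> ?P j (K i)" using that by (simp_all add: hole_at_def N_def d_def)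
    then obtain l where l: "1 \<le> l" "l < K i" "?P j l" "\<not> ?P j (Suc l)"
      using K_ge(2) by (rule last_true)
    have shift: "?P (j + int (N i)) l' \<longleftrightarrow> ?P j l'" if "l' \<le> K i" for l'
    proof -
      have "j + int (N i) - c l' = (j - c l') + int (N i)" by simp
      then show ?thesis
        using period_dvd [OF that] unfolding N_def by (metis dvd_add_left_iff int_dvd_int_iff)
    qed
    have "x (j + int (N i)) = x j"
      using letter [OF l(1,3,4)] letter [of l "j + int (N i)"] l shift [of l] shift [of "Suc l"] by simp
    moreover have "(m + (j + int (N i))) mod int p = (m + j) mod int p"
      using p_dvd [of "K i"] K_ge(1) [of i] by (simp add: mod_eq_dvd_iff N_def)
    ultimately show ?thesis by (simp add: W_def potential_def)
  qed
  have W_hole: "W j = E - complex_of_real (g (x j) r)" if "hole_at N d i j" for i j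
  proof -
    have "int (period n k0) dvd (j - c (K i)) + (c (K i) - c k0)"
      using that center_le [of k0 "K i"] period_dvd [of k0 "K i"] K_ge(1) [of i]
      unfolding hole_at_def N_def d_def by (meson dvd_add dvd_trans int_dvd_int_iff less_imp_le)
    then have "int p dvd j - c k0" using dvd_trans [OF p_dvd [of k0]] by simp
    then have "(m + j) mod int p = r" by (simp add: r_def mod_eq_dvd_iff)
    then show ?thesis by (simp add: W_def potential_def)
  qed
  have dec: "decaying \<psi>" using l2 by (rule summable_on_imp_decaying)
  \<comment> \<open>\<open>g\<close> may identify the two letters at the phase \<open>r\<close>.
    Then \<open>W\<close> is constant on the holes, hence periodic everywhere, and Gordon's argument
    suffices; otherwise the abstract setting applies.\<close>
  show False
  proof (cases "g (b (K 1)) r = g (b (K 0)) r")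
    case True
    have gA: "g z r = g (b (K 0)) r" if "z \<in> A" for z
      using binary [OF bA [of 1] bA [of 0] that] b_neq [of 0] True by auto
    have "W (j + int (N 0)) = W j" for j
    proof (cases "hole_at N d 0 j")
      case hole: True
      then have "hole_at N d 0 (j + int (N 0))"
        unfolding hole_at_def by (metis add_diff_eq add.commute dvd_add_right_iff dvd_refl)
      then show ?thesis using W_hole [OF hole] W_hole gA xA by metis
    qed (rule per)
    then show False
      using periodic_no_decaying_solution [OF sol dec, of "N 0" t] t by (simp add: N_def)
  next
    case False
    interpret eigenfunction W N d v \<psi> t
    proof
      fix k j
      show "0 < N k" by (simp add: N_def)
      show "N k dvd N (Suc k)" using K_Suc [of k] by (simp add: N_def period_dvd)
      show "2 * N k \<le> N (Suc k)" using K_Suc [of k] K_ge by (simp add: N_def period_less)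
      show "int (N k) dvd d (Suc k) - d k" using K_Suc [of k] by (simp add: N_def d_def center_le)
      show "W (j + int (N k)) = W j" if "\<not> hole_at N d k j" using that by (rule per)
      show "W j = v k" if h: "hole_at N d k j" "\<not> hole_at N d (Suc k) j"
      proof -
        obtain l where l: "K k \<le> l" "l < K (Suc k)" "int (period n l) dvd j - c l"
            "\<not> int (period n (Suc l)) dvd j - c (Suc l)"
          using h last_true [of "\<lambda>l. int (period n l) dvd j - c l" "K k" "K (Suc k)"] K_Suc [of k]
          unfolding hole_at_def N_def d_def by (metis less_imp_le)
        have "x j = b l" using l K_ge(2) [of k] by (intro letter) auto
        also have "\<dots> = b (K k)" using l by (intro K_gap)
        finally show ?thesis using W_hole [OF h(1)] by (simp add: v_def)
      qed
      show "W j = v k \<or> W j = v (Suc k)" if "hole_at N d k j"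
        using binary [OF bA [of "Suc k"] bA [of k] xA [of j] b_neq [of k]] W_hole [OF that] by (auto simp: v_def)
      show "v (Suc (Suc k)) = v k"
        using binary [OF bA [of "Suc k"] bA [of k] bA [of "Suc (Suc k)"] b_neq [of k]] b_neq [of "Suc k"] by (auto simp: v_def)
      show "v (Suc k) \<noteq> v k"
      proof -
        have "g (b (K (Suc k))) r \<noteq> g (b (K k)) r"
          using binary [OF bA [of 1] bA [of 0] bA [of k]] binary [OF bA [of 1] bA [of 0] bA [of "Suc k"]]
            b_neq [of 0] b_neq [of k] False by auto
        then show ?thesis by (simp add: v_def)
      qed
    qed (use sol l2 t in auto)
    show False by (rule contradiction)
  qed
qed

end

theorem theorem3p28:
  fixes A :: "real set" and b :: "nat \<Rightarrow> real" and n :: "nat \<Rightarrow> nat"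
    and p :: nat and g :: "real \<Rightarrow> int \<Rightarrow> real"
    and x :: "int \<Rightarrow> real" and m :: int
  assumes "card A = 2"
    and "coding_sequence A b n"
    and "commensurate p n"
    and "x \<in> toeplitz_subshift b n"
    and "0 \<le> m" and "m < int p"
  shows "\<not> (\<exists>E. is_eigenvalue (potential g p x m) E)"
proof -
  obtain k0 where "p dvd (\<Prod>k=1..k0. n k)" using assms(3) by (auto simp: commensurate_def)
  \<comment> \<open>\<open>period\<close> stops just before its index, hence
    \<open>Suc k0\<close>.\<close>
  then have "p dvd period n (Suc k0)" by (simp add: period_def atLeastLessThanSuc_atLeastAtMost)
  then show ?thesis
    using assms(1,2,4) no_eigenvalue [of n A b p "Suc k0" x g m] by (auto simp: coding_sequence_def)
qed

end
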